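(* Let $k\ge 1$ and $n\ge 1$, and let $f^1,\ldots,f^n$ be characteristic functions of $k$-rectangles in $[0,1]^k$, where $[0,1]^k$ carries Lebesgue measure. Then $E_n(f^1,\ldots,f^n)\ge 0$.
   Context: A $k$-rectangle is a subset of $[0,1]^k$ of the form $[0,r_1]\times\cdots\times[0,r_k]$ with $0\le r_1,\ldots,r_k\le 1$ (the $r_i$ may differ from one rectangle to another). Write $\mathcal{E}(f)=\int f$ for the integral with respect to Lebesgue measure. For $\sigma$ in the symmetric group $S_n$ with disjoint cycle decomposition $\sigma=(i_1,\ldots,i_p)(j_1,\ldots,j_q)\cdots$ (fixed points included as cycles of length 1), let $C_\sigma$ be the number of cycles and $$E_\sigma(f^1,\ldots,f^n)=\mathcal{E}(f^{i_1}\cdots f^{i_p})\,\mathcal{E}(f^{j_1}\cdots f^{j_q})\cdots .$$ Then $E_n(f^1,\ldots,f^n)=\sum_{\sigma\in S_n}(-1)^{C_\sigma-1}E_\sigma(f^1,\ldots,f^n)$. *)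

theory Defs
  imports "HOL-Analysis.Analysis" "HOL-Combinatorics.Orbits"
begin

text \<open>The dimension \<open>k\<close> is the cardinality of the index type \<open>'k\<close>; the unit cube is
  \<open>cbox 0 1\<close>, where \<open>1\<close> is the all-ones vector.\<close>

definition k_rectangle :: "(real ^ 'k) set \<Rightarrow> bool" where
  "k_rectangle R \<longleftrightarrow> (\<exists>r. (\<forall>j. 0 \<le> r $ j \<and> r $ j \<le> 1) \<and> R = {x. \<forall>j. x $ j \<in> {0..r $ j}})"

definition cube_integral :: "(real ^ 'k \<Rightarrow> real) \<Rightarrow> real" where
  "cube_integral f = integral\<^sup>L (lebesgue_on (cbox 0 1)) f"

text \<open>The products below depend only on the underlying set of each cycle, so a cycle is
  represented by that set, i.e. by an orbit. Since \<open>i \<in> orbit \<sigma> i\<close> for a permutation of a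
  finite set, a fixed point \<open>i\<close> contributes the cycle \<open>{i}\<close>.\<close>

definition cycle_sets :: "nat \<Rightarrow> (nat \<Rightarrow> nat) \<Rightarrow> nat set set" where
  "cycle_sets n \<sigma> = orbit \<sigma> ` {1..n}"

definition E_perm :: "nat \<Rightarrow> (nat \<Rightarrow> nat) \<Rightarrow> (nat \<Rightarrow> real ^ 'k \<Rightarrow> real) \<Rightarrow> real" where
  "E_perm n \<sigma> f = (\<Prod>c\<in>cycle_sets n \<sigma>. cube_integral (\<lambda>x. \<Prod>i\<in>c. f i x))"

text \<open>For \<open>n \<ge> 1\<close> there is at least one cycle, so the natural-number subtraction in the
  exponent does not truncate.\<close>

definition E_n :: "nat \<Rightarrow> (nat \<Rightarrow> real ^ 'k \<Rightarrow> real) \<Rightarrow> real" where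
  "E_n n f = (\<Sum>\<sigma> | \<sigma> permutes {1..n}. (-1) ^ (card (cycle_sets n \<sigma>) - 1) * E_perm n \<sigma> f)"

end

theory Submission
  imports Defs
begin

text \<open>Introduce a formal variable \<open>t\<^sub>i\<close> for each function. Grouping permutations by their cycle sets
  and using that a set \<open>B\<close> carries \<open>(card B - 1)!\<close> full cycles, the exponential formula identifies
  \<open>- E_n n f\<close> with the coefficient of \<open>t\<^sub>1 \<cdots> t\<^sub>n\<close> in
  \<open>exp (\<integral> log (1 - \<Sum>i. t\<^sub>i f\<^sub>i))\<close>, the geometric mean of \<open>1 - \<Sum>i. t\<^sub>i f\<^sub>i\<close>
  (\<open>coeff_set_exp_eq_cycle_sum\<close>). So it suffices that this geometric mean is \<open>1 - \<Phi>\<close> with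
  \<open>\<Phi> \<ge> 0\<close> coefficientwise.

  For rectangles, the integral of \<open>\<Prod>i\<in>B. f\<^sub>i\<close> is the product over the coordinates \<open>j\<close> of the minimum
  of the side lengths \<open>r i j\<close> over \<open>i \<in> B\<close>, and the coordinates can be added one at a time. With no
  coordinate the series is \<open>1 - \<Sum>i. t\<^sub>i\<close>. Adding a coordinate replaces \<open>1 - \<Phi>\<close> by a weighted
  geometric mean of the series \<open>1 - \<Phi>\<^sub>s\<close>, one for each level \<open>s\<close> of that coordinate, where \<open>\<Phi>\<^sub>s\<close>
  arises from \<open>\<Phi>\<close> by setting \<open>t\<^sub>i = 0\<close> whenever \<open>r i j < s\<close>. Hence \<open>\<Phi>\<^sub>s\<close> decreases
  coefficientwise as \<open>s\<close> grows.

  The heart of the proof is that the weighted geometric mean of such an increasing chain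
  \<open>1 - \<Phi>\<^sub>s\<close> is at most its last member and hence at most \<open>1\<close>. For two members this is \<open>set_exp_convex_le\<close>, and the chain
  is handled by merging it from the bottom level upwards (\<open>set_exp_truncated_levels\<close>).\<close>

section \<open>The ring of multilinear power series\<close>

text \<open>A series stands for \<open>\<Sum>S. a S \<cdot> t\<^sub>S\<close>, where \<open>S\<close> runs over the finite sets and
  \<open>t\<^sub>S = \<Prod>i\<in>S. t\<^sub>i\<close>, in the ring where every \<open>t\<^sub>i\<^sup>2\<close> is \<open>0\<close>. Passing to this quotient loses
  nothing, since only the coefficient of \<open>t\<^sub>1 \<cdots> t\<^sub>n\<close> is wanted, and it turns every identity
  between series into a finite recursion over subsets. Coefficients at infinite sets are fixed to be
  \<open>0\<close> because the convolution below would not determine them.\<close>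

typedef 'a set_series = "{a :: 'a set \<Rightarrow> real. \<forall>S. infinite S \<longrightarrow> a S = 0}"
  morphisms coeff Abs_set_series
  by (intro exI[of _ "\<lambda>_. 0"]) simp

definition set_series :: "('a set \<Rightarrow> real) \<Rightarrow> 'a set_series" where
  "set_series a = Abs_set_series (\<lambda>S. if finite S then a S else 0)"

lemma coeff_infinite: "infinite S \<Longrightarrow> coeff a S = 0"
  using coeff[of a] by simp

lemma coeff_set_series: "coeff (set_series a) S = (if finite S then a S else 0)"
  unfolding set_series_def by (subst Abs_set_series_inverse) auto

lemma set_series_eqI: "(\<And>S. finite S \<Longrightarrow> coeff a S = coeff b S) \<Longrightarrow> a = b"
  by (metis coeff_infinite coeff_inject ext)

instantiation set_series :: (type) comm_ring_1
begin

definition zero_set_series :: "'a set_series" where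
  "0 = set_series (\<lambda>_. 0)"
definition one_set_series :: "'a set_series" where
  "1 = set_series (\<lambda>S. if S = {} then 1 else 0)"
definition plus_set_series :: "'a set_series \<Rightarrow> 'a set_series \<Rightarrow> 'a set_series" where
  "a + b = set_series (\<lambda>S. coeff a S + coeff b S)"
definition minus_set_series :: "'a set_series \<Rightarrow> 'a set_series \<Rightarrow> 'a set_series" where
  "a - b = set_series (\<lambda>S. coeff a S - coeff b S)"
definition uminus_set_series :: "'a set_series \<Rightarrow> 'a set_series" where
  "- a = set_series (\<lambda>S. - coeff a S)"
definition times_set_series :: "'a set_series \<Rightarrow> 'a set_series \<Rightarrow> 'a set_series" where
  "a * b = set_series (\<lambda>S. \<Sum>T\<in>Pow S. coeff a T * coeff b (S - T))"

lemma coeff_ring_ops [simp]: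
  "coeff 0 S = 0"
  "coeff 1 S = (if S = {} then 1 else 0)"
  "coeff (a + b) S = coeff a S + coeff b S"
  "coeff (a - b) S = coeff a S - coeff b S"
  "coeff (- a) S = - coeff a S"
  by (auto simp: zero_set_series_def one_set_series_def plus_set_series_def minus_set_series_def
      uminus_set_series_def coeff_set_series coeff_infinite)

text \<open>For infinite \<open>S\<close> both sides are \<open>0\<close>, the right one because \<open>Pow S\<close> is infinite.\<close>

lemma coeff_mult: "coeff (a * b) S = (\<Sum>T\<in>Pow S. coeff a T * coeff b (S - T))"
  by (cases "finite S") (simp_all add: times_set_series_def coeff_set_series)

instance
proof
  fix a b c :: "'a set_series"
  show "a * b * c = a * (b * c)"
  proof (rule set_series_eqI)
    fix S :: "'a set" assume S: "finite S"
    have "coeff (a * b * c) S =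
        (\<Sum>T\<in>Pow S. \<Sum>U\<in>Pow T. coeff a U * coeff b (T - U) * coeff c (S - T))"
      by (simp add: coeff_mult sum_distrib_right)
    also have "\<dots> = (\<Sum>(T, U)\<in>Sigma (Pow S) Pow. coeff a U * coeff b (T - U) * coeff c (S - T))"
      using S by (subst sum.Sigma) (auto intro: finite_subset)
    also have "\<dots> = (\<Sum>(U, V)\<in>Sigma (Pow S) (\<lambda>U. Pow (S - U)).
        coeff a U * (coeff b V * coeff c (S - U - V)))"
      by (rule sum.reindex_bij_witness[where i = "\<lambda>(U, V). (U \<union> V, U)"
            and j = "\<lambda>(T, U). (U, T - U)"])
        (auto simp: Diff_eq intro!: arg_cong[where f = "coeff c"])
    also have "\<dots> = (\<Sum>U\<in>Pow S. \<Sum>V\<in>Pow (S - U). coeff a U * (coeff b V * coeff c (S - U - V)))"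
      using S by (subst sum.Sigma) auto
    also have "\<dots> = coeff (a * (b * c)) S"
      by (simp add: coeff_mult sum_distrib_left)
    finally show "coeff (a * b * c) S = coeff (a * (b * c)) S" .
  qed
  show "a * b = b * a"
  proof (rule set_series_eqI)
    fix S :: "'a set"
    show "coeff (a * b) S = coeff (b * a) S"
      unfolding coeff_mult
      by (rule sum.reindex_bij_witness[where i = "\<lambda>T. S - T" and j = "\<lambda>T. S - T"])
        (auto simp: double_diff)
  qed
  show "1 * a = a"
  proof (rule set_series_eqI)
    fix S :: "'a set" assume "finite S"
    then have "coeff (1 * a) S = (\<Sum>T\<in>{{}}. coeff 1 T * coeff a (S - T))"
      unfolding coeff_mult by (intro sum.mono_neutral_right) auto
    then show "coeff (1 * a) S = coeff a S" by simp
  qed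
  show "(0 :: 'a set_series) \<noteq> 1"
    by (metis coeff_ring_ops(1,2) zero_neq_one)
qed (rule set_series_eqI; simp add: coeff_mult distrib_right sum.distrib)+

end

instantiation set_series :: (type) real_algebra_1
begin

definition scaleR_set_series :: "real \<Rightarrow> 'a set_series \<Rightarrow> 'a set_series" where
  "c *\<^sub>R a = set_series (\<lambda>S. c * coeff a S)"

lemma coeff_scaleR [simp]: "coeff (c *\<^sub>R a) S = c * coeff a S"
  by (auto simp: scaleR_set_series_def coeff_set_series coeff_infinite)

instance
proof
  fix a b :: "'a set_series" and x :: real
  have left: "x *\<^sub>R a * b = x *\<^sub>R (a * b)" for a b :: "'a set_series"
    by (rule set_series_eqI) (simp add: coeff_mult sum_distrib_left mult.assoc)
  show "x *\<^sub>R a * b = x *\<^sub>R (a * b)" "a * x *\<^sub>R b = x *\<^sub>R (a * b)"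
    using left[of a b] left[of b a] by (simp_all add: mult.commute)
qed (rule set_series_eqI; simp add: algebra_simps)+

end

instantiation set_series :: (type) order
begin

definition less_eq_set_series :: "'a set_series \<Rightarrow> 'a set_series \<Rightarrow> bool" where
  "a \<le> b \<longleftrightarrow> (\<forall>S. coeff a S \<le> coeff b S)"
definition less_set_series :: "'a set_series \<Rightarrow> 'a set_series \<Rightarrow> bool" where
  "a < b \<longleftrightarrow> a \<le> b \<and> \<not> b \<le> (a :: 'a set_series)"

instance
proof
  fix a b :: "'a set_series"
  show "a \<le> b \<Longrightarrow> b \<le> a \<Longrightarrow> a = b"
    by (auto simp: less_eq_set_series_def intro: set_series_eqI antisym)
qed (auto simp: less_eq_set_series_def less_set_series_def intro: order_trans)

end

instance set_series :: (type) "{ordered_comm_ring, ordered_real_vector}"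
proof
  fix a b c :: "'a set_series"
  show "a \<le> b \<Longrightarrow> 0 \<le> c \<Longrightarrow> c * a \<le> c * b"
    by (auto simp: less_eq_set_series_def coeff_mult intro!: sum_mono mult_left_mono)
qed (auto simp: less_eq_set_series_def intro: mult_left_mono mult_right_mono)

section \<open>The Euler derivation and the exponential\<close>

text \<open>This is \<open>\<Sum>i. t\<^sub>i \<partial>/\<partial>t\<^sub>i\<close>. The partial derivatives themselves do not respect
  \<open>t\<^sub>i\<^sup>2 = 0\<close>, whereas each \<open>t\<^sub>i \<partial>/\<partial>t\<^sub>i\<close> does. Since the Euler operator multiplies each coefficient by
  a natural number that is positive outside the empty set, the sign of a series can be read off
  from its derivative.\<close>

definition euler :: "'a set_series \<Rightarrow> 'a set_series" where
  "euler a = set_series (\<lambda>S. real (card S) * coeff a S)"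

lemma coeff_euler [simp]: "coeff (euler a) S = real (card S) * coeff a S"
  by (simp add: euler_def coeff_set_series)

lemma euler_linear [simp]:
  "euler (a + b) = euler a + euler b" "euler (a - b) = euler a - euler b"
  "euler (- a) = - euler a" "euler (c *\<^sub>R a) = c *\<^sub>R euler a" "euler 0 = 0" "euler 1 = 0"
  by (rule set_series_eqI; simp add: algebra_simps)+

lemma euler_mult: "euler (a * b) = euler a * b + a * euler b"
proof (rule set_series_eqI)
  fix S :: "'a set" assume S: "finite S"
  have "real (card S) = real (card T) + real (card (S - T))" if "T \<subseteq> S" for T
    using that S by (metis card_Diff_subset card_mono finite_subset le_add_diff_inverse of_nat_add)
  then have "coeff (euler (a * b)) S =
      (\<Sum>T\<in>Pow S. (real (card T) + real (card (S - T))) * (coeff a T * coeff b (S - T)))"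
    by (simp add: coeff_mult sum_distrib_left)
  also have "\<dots> = coeff (euler a * b + a * euler b) S"
    unfolding coeff_ring_ops coeff_mult sum.distrib[symmetric]
    by (intro sum.cong) (auto simp: algebra_simps)
  finally show "coeff (euler (a * b)) S = coeff (euler a * b + a * euler b) S" .
qed

lemma nonneg_if_euler_nonneg:
  assumes "0 \<le> euler a" "0 \<le> coeff a {}"
  shows "0 \<le> a"
  unfolding less_eq_set_series_def
proof
  fix S :: "'a set"
  show "coeff 0 S \<le> coeff a S"
  proof (cases "S = {} \<or> infinite S")
    case False
    with assms(1) show ?thesis
      by (auto simp: less_eq_set_series_def zero_le_mult_iff card_gt_0_iff dest!: spec[of _ S])
  qed (use assms(2) in \<open>auto simp: coeff_infinite\<close>)
qed

lemma coeff_mult_empty [simp]: "coeff (a * b) {} = coeff a {} * coeff b {}"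
  by (simp add: coeff_mult)

text \<open>When \<open>a\<close> has no constant term, the coefficient of \<open>a * b\<close> at \<open>S\<close> involves \<open>b\<close> only on proper
  subsets. Hence equations such as \<open>euler b = a * b\<close> are recursions for \<open>b\<close>.\<close>

lemma coeff_mult_cong:
  assumes "coeff a {} = 0" "\<And>T. T \<subset> S \<Longrightarrow> coeff b T = coeff c T"
  shows "coeff (a * b) S = coeff (a * c) S"
  unfolding coeff_mult
proof (rule sum.cong)
  fix T assume "T \<in> Pow S"
  then show "coeff a T * coeff b (S - T) = coeff a T * coeff c (S - T)"
    using assms by (cases "T = {}") (auto intro!: assms(2))
qed simp

lemma euler_nonneg: "0 \<le> a \<Longrightarrow> 0 \<le> euler a"
  by (simp add: less_eq_set_series_def)

lemma euler_ode_unique: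
  assumes "euler a = l * a" "euler b = l * b" "coeff l {} = 0" "coeff a {} = coeff b {}"
  shows "a = b"
proof (rule set_series_eqI)
  fix S :: "'a set" assume "finite S"
  then show "coeff a S = coeff b S"
  proof (induction S rule: finite_psubset_induct)
    case (psubset S)
    show ?case
    proof (cases "S = {}")
      case False
      have "coeff (euler a) S = coeff (euler b) S"
        unfolding assms(1,2) by (rule coeff_mult_cong) (use assms(3) psubset in auto)
      then show ?thesis using False psubset by simp
    qed (use assms in simp)
  qed
qed

text \<open>This serves two recursions for \<open>a\<close>: the differential equation \<open>euler a = l * a\<close> of an
  exponential, and \<open>a = 1 + l * a\<close>, that is, \<open>a = 1 / (1 - l)\<close>.\<close>

lemma nonneg_by_recursion:
  assumes step: "\<And>S. finite S \<Longrightarrow> S \<noteq> {} \<Longrightarrow> 0 \<le> coeff (l * a) S \<Longrightarrow> 0 \<le> coeff a S"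
    and l: "0 \<le> l" "coeff l {} = 0" and "0 \<le> coeff a {}"
  shows "0 \<le> a"
proof -
  have "0 \<le> coeff a S" if "finite S" for S
    using that
  proof (induction S rule: finite_psubset_induct)
    case (psubset S)
    show ?case
    proof (cases "S = {}")
      case False
      have "0 \<le> coeff l T * coeff a (S - T)" if "T \<subseteq> S" for T
      proof (cases "T = {}")
        case False
        then have "S - T \<subset> S"
          using that by auto
        then show ?thesis
          using psubset.IH l(1) by (simp add: less_eq_set_series_def)
      qed (simp add: l(2))
      then have "0 \<le> coeff (l * a) S"
        unfolding coeff_mult by (intro sum_nonneg) auto
      then show ?thesis
        using psubset.hyps False by (intro step)
    qed (use assms in simp)
  qed
  then show ?thesis
    by (auto simp: less_eq_set_series_def) (metis coeff_infinite order_refl)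
qed

text \<open>The exponential is defined by solving \<open>euler g = euler l * g\<close> with constant term \<open>1\<close>. The
  constant term of \<open>l\<close> does not enter, as \<open>euler\<close> kills it.\<close>

function exp_coeff :: "('a set \<Rightarrow> real) \<Rightarrow> 'a set \<Rightarrow> real" where
  "exp_coeff l S = (if S = {} \<or> infinite S then 1 else
     (\<Sum>T\<in>Pow S - {{}}. real (card T) * l T * exp_coeff l (S - T)) / real (card S))"
  by auto
termination
  by (relation "Wellfounded.measure (\<lambda>(l, S). card S)") (auto intro!: psubset_card_mono)

declare exp_coeff.simps [simp del]

definition set_exp :: "'a set_series \<Rightarrow> 'a set_series" where
  "set_exp l = set_series (exp_coeff (coeff l))"

lemma coeff_set_exp_empty [simp]: "coeff (set_exp l) {} = 1"
  by (simp add: set_exp_def coeff_set_series exp_coeff.simps)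

lemma euler_set_exp: "euler (set_exp l) = euler l * set_exp l"
proof (rule set_series_eqI)
  fix S :: "'a set" assume S: "finite S"
  show "coeff (euler (set_exp l)) S = coeff (euler l * set_exp l) S"
  proof (cases "S = {}")
    case False
    have "coeff (euler (set_exp l)) S =
        (\<Sum>T\<in>Pow S - {{}}. real (card T) * coeff l T * exp_coeff (coeff l) (S - T))"
      using S False by (simp add: set_exp_def coeff_set_series exp_coeff.simps[of _ S])
    also have "\<dots> = coeff (euler l * set_exp l) S"
      unfolding coeff_mult using S
      by (intro sum.mono_neutral_cong_left) (auto simp: set_exp_def coeff_set_series)
    finally show ?thesis .
  qed simp
qed

lemma set_exp_unique:
  assumes "euler a = euler l * a" "coeff a {} = 1"
  shows "a = set_exp l"
  by (rule euler_ode_unique[OF assms(1) euler_set_exp]) (simp_all add: assms(2))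

lemma set_exp_0 [simp]: "set_exp 0 = 1"
  by (rule set_exp_unique[symmetric]) auto

lemma set_exp_add: "set_exp (l + m) = set_exp l * set_exp m"
  by (rule set_exp_unique[symmetric]) (auto simp: euler_mult euler_set_exp algebra_simps)

lemma set_exp_uminus_mult: "set_exp (- l) * set_exp l = 1"
  by (metis add.left_inverse set_exp_0 set_exp_add)

lemma set_exp_nonneg:
  assumes "0 \<le> euler l"
  shows "0 \<le> set_exp l"
proof (rule nonneg_by_recursion)
  fix S :: "'a set" assume "finite S" "S \<noteq> {}" "0 \<le> coeff (euler l * set_exp l) S"
  then show "0 \<le> coeff (set_exp l) S"
    unfolding euler_set_exp[symmetric] by (simp add: zero_le_mult_iff card_gt_0_iff)
qed (use assms in auto)

text \<open>Write \<open>set_exp l = 1 - \<Phi>\<close> with \<open>\<Phi> \<ge> 0\<close>. The reciprocal \<open>1 / (1 - \<Phi>)\<close> is a geometric series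
  and hence nonnegative, and \<open>- euler l = euler \<Phi> / (1 - \<Phi>)\<close>.\<close>

lemma euler_log_nonpos:
  assumes "set_exp l \<le> 1"
  shows "0 \<le> - euler l" "0 \<le> set_exp (- l)"
proof -
  have rec: "(1 - set_exp l) * set_exp (- l) = set_exp (- l) - 1"
    using set_exp_uminus_mult[of l] by (simp add: algebra_simps)
  show inv: "0 \<le> set_exp (- l)"
  proof (rule nonneg_by_recursion)
    fix S :: "'a set"
    assume "finite S" "S \<noteq> {}" "0 \<le> coeff ((1 - set_exp l) * set_exp (- l)) S"
    then show "0 \<le> coeff (set_exp (- l)) S"
      by (simp only: rec coeff_ring_ops if_False diff_zero)
  qed (use assms in simp_all)
  have "- euler l = - euler (set_exp l) * set_exp (- l)"
    using set_exp_uminus_mult[of l] by (simp add: euler_set_exp algebra_simps)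
  moreover have "0 \<le> - euler (set_exp l)"
    using euler_nonneg[of "1 - set_exp l"] assms by simp
  ultimately show "0 \<le> - euler l"
    using inv by (metis mult_nonneg_nonneg)
qed

section \<open>Geometric means of two exponentials\<close>

text \<open>Write \<open>set_exp m = 1 - \<Phi>\<close> and \<open>set_exp l = 1 - \<Phi> - \<Psi>\<close> with \<open>\<Phi>, \<Psi> \<ge> 0\<close>, and put
  \<open>Q = \<Psi> / (1 - \<Phi>) \<ge> 0\<close>. The weighted geometric mean of the two series is
  \<open>(1 - \<Phi>) (1 - Q)\<^sup>a = (1 - \<Phi>) (1 - c\<^sub>1 Q - c\<^sub>2 Q\<^sup>2 - \<dots>)\<close> with all \<open>c\<^sub>k \<ge> 0\<close>, and
  \<open>(1 - \<Phi>) Q\<^sup>k = \<Psi> Q\<^bsup>k-1\<^esup> \<ge> 0\<close>. So the mean is \<open>1 - \<Phi>\<close> minus something nonnegative.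

  The proof replaces the binomial series by the Euler derivation. Here \<open>set_exp N = 1 - Q\<close>,
  \<open>P\<close> is the mean, and \<open>X\<close> and \<open>Y\<close> are the quotients of \<open>P\<close> by \<open>set_exp l\<close> and by \<open>set_exp m\<close>,
  that is, \<open>(1 - Q)\<^bsup>a-1\<^esup>\<close> and \<open>(1 - Q)\<^sup>a\<close>.\<close>

lemma set_exp_convex_le:
  assumes le: "set_exp l \<le> set_exp m" and m: "set_exp m \<le> 1"
    and a: "0 \<le> a" "a \<le> 1"
  shows "set_exp (a *\<^sub>R l + (1 - a) *\<^sub>R m) \<le> set_exp m"
proof -
  define N where "N = l - m"
  define P where "P = set_exp (a *\<^sub>R l + (1 - a) *\<^sub>R m)"
  define X where "X = set_exp ((1 - a) *\<^sub>R - N)"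
  define Y where "Y = set_exp (a *\<^sub>R N)"
  define W where "W = a *\<^sub>R X + (1 - a) *\<^sub>R Y - 1"
  have PX: "P = set_exp l * X" and PY: "P = set_exp m * Y" and YX: "Y = set_exp N * X"
    unfolding P_def X_def Y_def N_def set_exp_add[symmetric]
    by (rule arg_cong[where f = set_exp]; simp add: algebra_simps)+
  have "1 - set_exp N = (set_exp m - set_exp l) * set_exp (- m)"
    using set_exp_uminus_mult[of m] set_exp_add[of l "- m"] unfolding N_def
    by (simp add: algebra_simps)
  then have N_le: "0 \<le> 1 - set_exp N"
    using le euler_log_nonpos(2)[OF m] by simp
  then have DN: "0 \<le> - euler N"
    by (intro euler_log_nonpos(1)) simp
  then have X: "0 \<le> X"
    unfolding X_def using a
    by (intro set_exp_nonneg) (simp only: euler_linear, intro scaleR_nonneg_nonneg, auto)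
  \<comment> \<open>\<open>Y\<close> may have negative coefficients, but its weighted mean with \<open>X\<close> is at least \<open>1\<close>,
    because in the derivative the two parts combine to the nonnegative \<open>X - Y = Q X\<close>.\<close>
  have "euler W = (a * (1 - a)) *\<^sub>R (- euler N * (1 - set_exp N) * X)"
    unfolding W_def by (simp add: X_def Y_def euler_set_exp)
      (simp add: YX[unfolded X_def Y_def] algebra_simps)
  then have "0 \<le> euler W"
    using a N_le DN X by (metis diff_ge_0_iff_ge mult_nonneg_nonneg scaleR_nonneg_nonneg)
  then have W: "0 \<le> W"
    by (rule nonneg_if_euler_nonneg) (simp add: W_def X_def Y_def)
  have "euler P = a *\<^sub>R (euler l * P) + (1 - a) *\<^sub>R (euler m * P)"
    unfolding P_def by (simp add: euler_set_exp distrib_right)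
  also have "\<dots> = a *\<^sub>R (euler (set_exp l) * X) + (1 - a) *\<^sub>R (euler (set_exp m) * Y)"
    by (subst PX, subst PY) (simp add: euler_set_exp mult.assoc)
  finally have "euler (set_exp m - P) =
      a *\<^sub>R (euler (set_exp m - set_exp l) * X) + euler (1 - set_exp m) * W"
    unfolding W_def by (simp add: algebra_simps)
  moreover have "0 \<le> euler (set_exp m - set_exp l)" "0 \<le> euler (1 - set_exp m)"
    using le m by (auto intro!: euler_nonneg simp del: euler_linear)
  ultimately have "0 \<le> euler (set_exp m - P)"
    using a X W by (metis add_nonneg_nonneg mult_nonneg_nonneg scaleR_nonneg_nonneg)
  then have "0 \<le> set_exp m - P"
    by (rule nonneg_if_euler_nonneg) (simp add: P_def)
  then show ?thesis
    by (simp add: P_def)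
qed

section \<open>Multiplication of the logarithm by a minimum\<close>

text \<open>The substitution \<open>t\<^sub>i = 0\<close> for all \<open>i\<close> outside \<open>A\<close>, a ring homomorphism.\<close>

definition restrict_series :: "'a set \<Rightarrow> 'a set_series \<Rightarrow> 'a set_series" where
  "restrict_series A a = set_series (\<lambda>S. if S \<subseteq> A then coeff a S else 0)"

lemma coeff_restrict_series [simp]:
  "coeff (restrict_series A a) S = (if S \<subseteq> A then coeff a S else 0)"
  by (auto simp: restrict_series_def coeff_set_series coeff_infinite)

lemma restrict_series_mult:
  "restrict_series A (a * b) = restrict_series A a * restrict_series A b"
proof (rule set_series_eqI)
  fix S
  have *: "T \<subseteq> A \<and> S - T \<subseteq> A \<longleftrightarrow> S \<subseteq> A" if "T \<subseteq> S" for T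
    using that by auto
  show "coeff (restrict_series A (a * b)) S = coeff (restrict_series A a * restrict_series A b) S"
  proof (cases "S \<subseteq> A")
    case True
    then show ?thesis
      unfolding coeff_mult coeff_restrict_series using * by (auto intro!: sum.cong)
  next
    case False
    have "coeff (restrict_series A a * restrict_series A b) S = 0"
      unfolding coeff_mult using False * by (intro sum.neutral) auto
    with False show ?thesis by simp
  qed
qed

lemma set_exp_restrict: "set_exp (restrict_series A l) = restrict_series A (set_exp l)"
proof (rule set_exp_unique[symmetric])
  have D: "euler (restrict_series A a) = restrict_series A (euler a)" for a
    by (rule set_series_eqI) simp
  show "euler (restrict_series A (set_exp l)) = euler (restrict_series A l) * restrict_series A (set_exp l)"
    by (simp add: D euler_set_exp restrict_series_mult)
qed simp

lemma set_exp_restrict_antimono: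
  assumes "set_exp l \<le> 1" "A \<subseteq> A'"
  shows "set_exp (restrict_series A' l) \<le> set_exp (restrict_series A l)"
  unfolding set_exp_restrict less_eq_set_series_def
proof
  fix S
  have "coeff (set_exp l) S \<le> 0" if "S \<noteq> {}"
    using assms(1) that by (metis coeff_ring_ops(2) less_eq_set_series_def)
  then show "coeff (restrict_series A' (set_exp l)) S \<le> coeff (restrict_series A (set_exp l)) S"
    using assms(2) by auto
qed

lemma set_exp_cong:
  assumes "\<And>S. finite S \<Longrightarrow> S \<noteq> {} \<Longrightarrow> coeff l S = coeff m S"
  shows "set_exp l = set_exp m"
proof (rule set_exp_unique)
  have "euler l = euler m"
  proof (rule set_series_eqI)
    fix S :: "'a set" assume "finite S"
    then show "coeff (euler l) S = coeff (euler m) S"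
      using assms by (cases "S = {}") auto
  qed
  then show "euler (set_exp l) = euler m * set_exp l"
    by (simp add: euler_set_exp)
qed simp

lemma set_exp_restrict_empty: "set_exp (restrict_series {} l) = 1"
  using set_exp_cong[of "restrict_series {} l" 0] by simp

text \<open>By layers, \<open>Min (r ` B)\<close> is a mixture of the indicators of \<open>B \<subseteq> {i. s \<le> r i}\<close> over the levels
  \<open>s\<close>, so multiplying \<open>l\<close> by it gives a convex combination of restrictions of \<open>l\<close>. The levels
  enter from the bottom, one at a time: \<open>K\<close> is the normalised combination of the levels up to \<open>s\<close>,
  and each step combines two series to which the result on geometric means applies. What makes the
  induction work is the upper bound for \<open>set_exp K\<close> by the exponential of the last restriction,
  which increases when the restriction shrinks. The equation is multiplied by \<open>s\<close> to allow
  \<open>s = 0\<close>.\<close>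

lemma set_exp_truncated_levels:
  assumes l: "set_exp l \<le> 1" and r: "\<And>i. 0 \<le> r i"
    and fin: "finite {i. r i < 1}" and s: "0 \<le> s" "s \<le> 1"
  shows "\<exists>K. set_exp K \<le> set_exp (restrict_series {i. s \<le> r i} l) \<and>
      (\<forall>B. finite B \<longrightarrow> B \<noteq> {} \<longrightarrow> s * coeff K B = coeff l B * min (Min (r ` B)) s)"
  using s
proof (induction "card {i. r i < s}" arbitrary: s rule: less_induct)
  case less
  have fin_s: "finite {i. r i < s}"
    using fin less.prems by (auto intro: finite_subset[rotated])
  show ?case
  proof (cases "{i. r i < s} = {}")
    case True
    then have ge: "s \<le> r i" for i
      using not_less by auto
    then have "restrict_series {i. s \<le> r i} l = l"
      by (intro set_series_eqI) auto
    moreover have "min (Min (r ` B)) s = s" if "finite B" "B \<noteq> {}" for B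
      using that ge by (intro min_absorb2) simp
    ultimately show ?thesis
      by (intro exI[of _ l]) simp
  next
    case False
    \<comment> \<open>The previous level; between \<open>s'\<close> and \<open>s\<close> there is no value of \<open>r\<close>.\<close>
    define s' where "s' = Max (r ` {i. r i < s})"
    have s'_in: "s' \<in> r ` {i. r i < s}"
      unfolding s'_def using fin_s False by (intro Max_in) auto
    then have s': "0 \<le> s'" "s' < s"
      using r by auto
    have gap: "r i \<le> s'" if "r i < s" for i
      unfolding s'_def using fin_s that by (intro Max_ge) auto
    have "{i. r i < s'} \<subset> {i. r i < s}"
      using s'_in s' by force
    then have "card {i. r i < s'} < card {i. r i < s}"
      using fin_s by (rule psubset_card_mono[rotated])
    then obtain K' where K': "set_exp K' \<le> set_exp (restrict_series {i. s' \<le> r i} l)"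
        "\<And>B. finite B \<Longrightarrow> B \<noteq> {} \<Longrightarrow> s' * coeff K' B = coeff l B * min (Min (r ` B)) s'"
      using less.hyps[of s'] s' less.prems by auto
    define L where "L = restrict_series {i. s \<le> r i} l"
    define K where "K = (s' / s) *\<^sub>R K' + (1 - s' / s) *\<^sub>R L"
    have "{i. s \<le> r i} \<subseteq> {i. s' \<le> r i}"
      using s' by auto
    then have "set_exp K' \<le> set_exp L"
      using K'(1) set_exp_restrict_antimono[OF l] unfolding L_def by (blast intro: order_trans)
    moreover have "set_exp L \<le> 1"
      using set_exp_restrict_antimono[OF l, of "{}" "{i. s \<le> r i}"]
      unfolding L_def by (simp add: set_exp_restrict_empty)
    ultimately have "set_exp K \<le> set_exp L"
      unfolding K_def using s' by (intro set_exp_convex_le) (auto simp: divide_le_eq_1)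
    moreover have "s * coeff K B = coeff l B * min (Min (r ` B)) s" if B: "finite B" "B \<noteq> {}" for B
    proof -
      have "s * coeff K B = s' * coeff K' B + (s - s') * coeff L B"
        unfolding K_def using s' by (simp add: field_simps)
      also have "\<dots> = coeff l B * min (Min (r ` B)) s' + (s - s') * coeff L B"
        using K'(2)[OF B] by simp
      also have "\<dots> = coeff l B * min (Min (r ` B)) s"
      proof (cases "s \<le> Min (r ` B)")
        case True
        then have "B \<subseteq> {i. s \<le> r i}"
          using B by auto
        then show ?thesis
          using True s' by (simp add: L_def algebra_simps)
      next
        case False
        moreover have "Min (r ` B) \<in> r ` B"
          using B by (intro Min_in) auto
        ultimately obtain i where i: "i \<in> B" "Min (r ` B) = r i" "r i < s"
          by force
        then have "\<not> B \<subseteq> {i. s \<le> r i}" by auto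
        then show ?thesis
          using i gap[of i] s' by (simp add: L_def)
      qed
      finally show ?thesis .
    qed
    ultimately show ?thesis
      unfolding L_def by blast
  qed
qed

lemma set_exp_scale_Min:
  assumes l: "set_exp l \<le> 1" and r: "\<And>i. 0 \<le> r i" "\<And>i. r i \<le> 1"
    and fin: "finite {i. r i < 1}"
    and m: "\<And>B. finite B \<Longrightarrow> B \<noteq> {} \<Longrightarrow> coeff m B = coeff l B * Min (r ` B)"
  shows "set_exp m \<le> 1"
proof -
  obtain K where K: "set_exp K \<le> set_exp (restrict_series {i. 1 \<le> r i} l)"
      "\<And>B. finite B \<Longrightarrow> B \<noteq> {} \<Longrightarrow> coeff K B = coeff l B * min (Min (r ` B)) 1"
    using set_exp_truncated_levels[OF l r(1) fin, of 1] by auto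
  have "Min (r ` B) \<le> 1" if "finite B" "B \<noteq> {}" for B
    using that r(2) by (meson Min_le all_not_in_conv finite_imageI imageI order_trans)
  then have "set_exp m = set_exp K"
    using K(2) m by (intro set_exp_cong) (simp add: min_absorb1)
  also have "\<dots> \<le> set_exp (restrict_series {} l)"
    using K(1) set_exp_restrict_antimono[OF l, of "{}" "{i. 1 \<le> r i}"] by (auto intro: order_trans)
  also have "\<dots> = 1"
    by (rule set_exp_restrict_empty)
  finally show ?thesis .
qed

text \<open>The series is \<open>log (1 - \<Sum>i. t\<^sub>i)\<close>: as \<open>(\<Sum>i. t\<^sub>i)\<^sup>k\<close> equals \<open>k!\<close> times the sum of all \<open>t\<^sub>B\<close> with
  \<open>card B = k\<close>, the term \<open>- (\<Sum>i. t\<^sub>i)\<^sup>k / k\<close> has the coefficients \<open>- (k - 1)!\<close>.\<close>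

lemma set_exp_log_one_minus_vars:
  "set_exp (set_series (\<lambda>B. - fact (card B - 1))) \<le> 1"
proof -
  define l :: "'a set_series" where "l = set_series (\<lambda>B. - fact (card B - 1))"
  \<comment> \<open>\<open>G\<close> is \<open>1 - \<Sum>i. t\<^sub>i\<close>.\<close>
  define G :: "'a set_series" where
    "G = set_series (\<lambda>S. if S = {} then 1 else if card S = 1 then - 1 else 0)"
  have l_coeff: "coeff (euler l) T = (if T = {} then 0 else - fact (card T))" if "finite T" for T
  proof (cases "T = {}")
    case False
    with that have "0 < card T" by (simp add: card_gt_0_iff)
    then show ?thesis
      using that False by (simp add: l_def coeff_set_series fact_reduce)
  qed simp
  have "euler G = euler l * G"
  proof (rule set_series_eqI)
    fix S :: "'a set" assume S: "finite S"
    show "coeff (euler G) S = coeff (euler l * G) S"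
    proof (cases "S = {}")
      case False
      then have pos: "0 < card S" using S by (simp add: card_gt_0_iff)
      have "coeff (euler l * G) S = (\<Sum>U\<in>Pow S. coeff G U * coeff (euler l) (S - U))"
        by (subst mult.commute) (rule coeff_mult)
      also have "\<dots> = (\<Sum>U\<in>insert {} ((\<lambda>i. {i}) ` S). coeff G U * coeff (euler l) (S - U))"
      proof (intro sum.mono_neutral_right ballI)
        fix U assume "U \<in> Pow S - insert {} ((\<lambda>i. {i}) ` S)"
        then have "U \<noteq> {}" "card U \<noteq> 1"
          by (auto elim!: card_1_singletonE simp del: One_nat_def)
        then have "coeff G U = 0"
          by (simp add: G_def coeff_set_series)
        then show "coeff G U * coeff (euler l) (S - U) = 0"
          by simp
      qed (use S in auto)
      also have "\<dots> = coeff (euler l) S - (\<Sum>i\<in>S. coeff (euler l) (S - {i}))"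
        using S by (subst sum.insert) (auto simp: sum.reindex inj_on_def G_def coeff_set_series sum_negf)
      also have "\<dots> = coeff (euler G) S"
      proof (cases "card S = 1")
        case True
        then obtain x where "S = {x}"
          by (rule card_1_singletonE)
        then show ?thesis
          by (simp add: l_def G_def coeff_set_series)
      next
        case c: False
        have "coeff (euler l) (S - {i}) = - fact (card S - 1)" if "i \<in> S" for i
        proof -
          have "S - {i} \<noteq> {}"
          proof
            assume "S - {i} = {}"
            with that have "S = {i}" by auto
            with c show False by simp
          qed
          then show ?thesis
            using S that by (simp add: l_coeff del: coeff_euler)
        qed
        then have "coeff (euler l) S - (\<Sum>i\<in>S. coeff (euler l) (S - {i})) = 0"
          using S False pos fact_reduce[of "card S", where 'a = real]
          by (simp add: l_coeff del: coeff_euler)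
        then show ?thesis
          using c False S by (simp add: G_def coeff_set_series)
      qed
      finally show ?thesis by simp
    qed simp
  qed
  then have "set_exp l = G"
    by (intro set_exp_unique[symmetric]) (auto simp: G_def coeff_set_series)
  also have "G \<le> 1"
    by (auto simp: less_eq_set_series_def G_def coeff_set_series)
  finally show ?thesis
    by (simp add: l_def)
qed

text \<open>Starting from \<open>log (1 - \<Sum>i. t\<^sub>i)\<close>, the factors \<open>Min ((\<lambda>i. r i j) ` B)\<close> enter one coordinate
  \<open>j\<close> at a time, and each preserves that the exponential is at most \<open>1\<close>.\<close>

lemma set_exp_prod_Min:
  fixes r :: "'a \<Rightarrow> 'j \<Rightarrow> real"
  assumes "finite J" "finite I" and r: "\<And>i j. i \<in> I \<Longrightarrow> j \<in> J \<Longrightarrow> 0 \<le> r i j \<and> r i j \<le> 1"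
    and m: "\<And>B. B \<subseteq> I \<Longrightarrow> B \<noteq> {} \<Longrightarrow> 
       coeff m B = - fact (card B - 1) * (\<Prod>j\<in>J. Min ((\<lambda>i. r i j) ` B))"
    and S: "S \<subseteq> I" "S \<noteq> {}"
  shows "coeff (set_exp m) S \<le> 0"
proof -
  \<comment> \<open>Outside \<open>I\<close> the value \<open>1\<close> ensures that \<open>{i. \<rho> j i < 1}\<close> is finite.\<close>
  define \<rho> where "\<rho> j i = (if i \<in> I then r i j else 1)" for j i
  define M where "M J = set_series (\<lambda>B. - fact (card B - 1) * (\<Prod>j\<in>J. Min (\<rho> j ` B)))" for J
  have "set_exp (M J) \<le> 1"
    using assms(1) r
  proof (induction J rule: finite_induct)
    case empty
    then show ?case
      using set_exp_log_one_minus_vars by (simp add: M_def)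
  next
    case (insert j J)
    show ?case
    proof (rule set_exp_scale_Min)
      show "set_exp (M J) \<le> 1"
        using insert by auto
      show "finite {i. \<rho> j i < 1}"
        by (rule finite_subset[OF _ assms(2)]) (auto simp: \<rho>_def)
      show "0 \<le> \<rho> j i" "\<rho> j i \<le> 1" for i
        using insert.prems by (auto simp: \<rho>_def)
      show "coeff (M (insert j J)) B = coeff (M J) B * Min (\<rho> j ` B)" if "finite B" for B
        using that insert by (simp add: M_def coeff_set_series mult_ac)
    qed
  qed
  then have "coeff (set_exp (restrict_series I (M J))) S \<le> 0"
    using S by (simp add: set_exp_restrict) (metis coeff_ring_ops(2) less_eq_set_series_def)
  moreover have "set_exp (restrict_series I (M J)) = set_exp (restrict_series I m)"
  proof (rule set_exp_cong)
    fix B :: "'a set" assume B: "finite B" "B \<noteq> {}"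
    have "(\<lambda>i. r i j) ` B = \<rho> j ` B" if "B \<subseteq> I" for j
      using that by (auto simp: \<rho>_def)
    then show "coeff (restrict_series I (M J)) B = coeff (restrict_series I m) B"
      using B m by (simp add: M_def coeff_set_series)
  qed
  ultimately have "coeff (restrict_series I (set_exp m)) S \<le> 0"
    by (simp only: set_exp_restrict)
  with S show ?thesis
    by simp
qed

section \<open>Sums over permutations as exponentials\<close>

definition cycle_sum :: "('a set \<Rightarrow> real) \<Rightarrow> 'a set \<Rightarrow> real" where
  "cycle_sum w S = (\<Sum>\<sigma> | \<sigma> permutes S. \<Prod>c\<in>orbit \<sigma> ` S. w c)"

definition full_cycles :: "'a \<Rightarrow> 'a set \<Rightarrow> ('a \<Rightarrow> 'a) set" where
  "full_cycles i T = {\<alpha>. \<alpha> permutes T \<and> orbit \<alpha> i = T}"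

text \<open>The next two lemmas are the two directions of the bijection between the permutations of \<open>S\<close> for
  which the cycle of \<open>i\<close> is \<open>T\<close>, and the pairs of a full cycle on \<open>T\<close> and a permutation of
  \<open>S - T\<close>.\<close>

lemma compose_full_cycle:
  assumes S: "finite S" and T: "T \<subseteq> S" "i \<in> T"
    and \<alpha>: "\<alpha> \<in> full_cycles i T" and \<beta>: "\<beta> permutes S - T"
  shows "\<alpha> \<circ> \<beta> permutes S" "orbit (\<alpha> \<circ> \<beta>) i = T"
    "perm_restrict (\<alpha> \<circ> \<beta>) T = \<alpha>" "perm_restrict (\<alpha> \<circ> \<beta>) (S - T) = \<beta>"
    "orbit (\<alpha> \<circ> \<beta>) ` S = insert T (orbit \<beta> ` (S - T))"
proof -
  have \<alpha>T: "\<alpha> permutes T" and orb: "orbit \<alpha> i = T"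
    using \<alpha> by (auto simp: full_cycles_def)
  have on_T: "(\<alpha> \<circ> \<beta>) x = \<alpha> x" if "x \<in> T" for x
    using that \<beta> by (simp add: permutes_not_in)
  have on_ST: "(\<alpha> \<circ> \<beta>) x = \<beta> x" if "x \<in> S - T" for x
    using that permutes_in_image[OF \<beta>, of x] permutes_not_in[OF \<alpha>T, of "\<beta> x"] by auto
  show "\<alpha> \<circ> \<beta> permutes S"
    using \<alpha>T \<beta> T by (intro permutes_compose) (auto intro: permutes_subset)
  show orb_i: "orbit (\<alpha> \<circ> \<beta>) i = T"
    using orb T on_T orbit_cong[of i \<alpha> "\<alpha> \<circ> \<beta>"] by auto
  show "perm_restrict (\<alpha> \<circ> \<beta>) T = \<alpha>"
    using on_T permutes_not_in[OF \<alpha>T]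
    by (auto simp: perm_restrict_def fun_eq_iff simp del: comp_apply)
  show "perm_restrict (\<alpha> \<circ> \<beta>) (S - T) = \<beta>"
    using on_ST \<beta> permutes_not_in[OF \<beta>]
    by (auto simp: perm_restrict_def fun_eq_iff simp del: comp_apply)
  have "orbit (\<alpha> \<circ> \<beta>) x = orbit \<beta> x" if "x \<in> S - T" for x
  proof (rule orbit_cong)
    show "x \<in> orbit \<beta> x"
      using \<beta> S by (intro permutation_self_in_orbit) (auto simp: permutation_permutes)
    show "(\<alpha> \<circ> \<beta>) s = \<beta> s" if "s \<in> orbit \<beta> x" for s
      using that permutes_orbit_subset[OF \<beta> \<open>x \<in> S - T\<close>] on_ST by auto
  qed
  moreover have "orbit (\<alpha> \<circ> \<beta>) x = T" if "x \<in> T" for x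
  proof (rule orbit_cyclic_eq3[OF _ that])
    show "cyclic_on (\<alpha> \<circ> \<beta>) T"
      using orb_i T by (auto intro: cyclic_on_singleI)
  qed
  ultimately have "orbit (\<alpha> \<circ> \<beta>) ` T = {T}"
      "orbit (\<alpha> \<circ> \<beta>) ` (S - T) = orbit \<beta> ` (S - T)"
    using T by auto
  moreover have "orbit (\<alpha> \<circ> \<beta>) ` S =
      orbit (\<alpha> \<circ> \<beta>) ` T \<union> orbit (\<alpha> \<circ> \<beta>) ` (S - T)"
    using T by blast
  ultimately show "orbit (\<alpha> \<circ> \<beta>) ` S = insert T (orbit \<beta> ` (S - T))"
    by simp
qed

lemma split_off_orbit:
  assumes S: "finite S" and \<sigma>: "\<sigma> permutes S" and T: "T = orbit \<sigma> i" and i: "i \<in> S"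
  shows "perm_restrict \<sigma> T \<in> full_cycles i T" "perm_restrict \<sigma> (S - T) permutes S - T"
    "perm_restrict \<sigma> T \<circ> perm_restrict \<sigma> (S - T) = \<sigma>"
proof -
  have cyc: "cyclic_on \<sigma> T"
    unfolding T using \<sigma> S by (rule cyclic_on_orbit)
  have TS: "T \<subseteq> S"
    unfolding T using \<sigma> i by (rule permutes_orbit_subset)
  then have fin: "finite T"
    using S by (rule finite_subset)
  have "\<sigma> ` T = T"
    using cyc fin permutes_inj[OF \<sigma>] cyclic_on_inI[OF cyc]
    by (intro endo_inj_surj) (auto intro: inj_on_subset)
  then have "bij_betw (perm_restrict \<sigma> T) T T"
    using permutes_inj[OF \<sigma>] by (auto simp: bij_betw_def perm_restrict_def inj_on_def)
  then have permT: "perm_restrict \<sigma> T permutes T"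
    by (rule bij_imp_permutes) (simp add: perm_restrict_def)
  have "cyclic_on (perm_restrict \<sigma> T) T"
    using cyc by (simp add: cyclic_on_perm_restrict)
  moreover have "i \<in> T"
    unfolding T using \<sigma> S by (intro permutation_self_in_orbit) (auto simp: permutation_permutes)
  ultimately show "perm_restrict \<sigma> T \<in> full_cycles i T"
    using permT by (simp add: full_cycles_def orbit_cyclic_eq3)
  show permST: "perm_restrict \<sigma> (S - T) permutes S - T"
    using \<sigma> cyc by (rule perm_restrict_diff_cyclic)
  show "perm_restrict \<sigma> T \<circ> perm_restrict \<sigma> (S - T) = \<sigma>"
    using perm_restrict_union[OF permT permST] TS \<sigma> by (simp add: Un_absorb1)
qed

lemma cycle_sum_split:
  assumes S: "finite S" and i: "i \<in> S"
  shows "cycle_sum w S = (\<Sum>T | T \<in> Pow S \<and> i \<in> T.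
    real (card (full_cycles i T)) * w T * cycle_sum w (S - T))"
proof -
  have self: "i \<in> orbit \<sigma> i" if "\<sigma> permutes S" for \<sigma>
    using that S by (intro permutation_self_in_orbit) (auto simp: permutation_permutes)
  have "cycle_sum w S = (\<Sum>T | T \<in> Pow S \<and> i \<in> T.
      \<Sum>\<sigma> | \<sigma> \<in> {\<sigma>. \<sigma> permutes S} \<and> orbit \<sigma> i = T. \<Prod>c\<in>orbit \<sigma> ` S. w c)"
    unfolding cycle_sum_def
    using S i self
    by (intro sum.group[symmetric]) (auto simp: finite_permutations dest: permutes_orbit_subset)
  also have "\<dots> = (\<Sum>T | T \<in> Pow S \<and> i \<in> T.
      real (card (full_cycles i T)) * w T * cycle_sum w (S - T))"
  proof (rule sum.cong)
    fix T assume "T \<in> {T. T \<in> Pow S \<and> i \<in> T}"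
    then have T: "T \<subseteq> S" "i \<in> T" by auto
    have weight: "(\<Prod>c\<in>orbit (\<alpha> \<circ> \<beta>) ` S. w c) = w T * (\<Prod>c\<in>orbit \<beta> ` (S - T). w c)"
      if "\<alpha> \<in> full_cycles i T" "\<beta> permutes S - T" for \<alpha> \<beta>
    proof -
      have "T \<notin> orbit \<beta> ` (S - T)"
        using permutes_orbit_subset[OF that(2)] T by blast
      then show ?thesis
        using compose_full_cycle(5)[OF S T that] S by simp
    qed
    have weight_split: "w T * (\<Prod>c\<in>orbit (perm_restrict \<sigma> (S - T)) ` (S - T). w c) =
        (\<Prod>c\<in>orbit \<sigma> ` S. w c)" if \<sigma>: "\<sigma> permutes S" "orbit \<sigma> i = T" for \<sigma>
    proof -
      note split = split_off_orbit[OF S \<sigma>(1) \<sigma>(2)[symmetric] i]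
      show ?thesis
        using weight[OF split(1,2)] by (simp only: split(3))
    qed
    have "(\<Sum>\<sigma> | \<sigma> \<in> {\<sigma>. \<sigma> permutes S} \<and> orbit \<sigma> i = T. \<Prod>c\<in>orbit \<sigma> ` S. w c) =
        (\<Sum>(\<alpha>, \<beta>)\<in>full_cycles i T \<times> {\<beta>. \<beta> permutes S - T}. w T * (\<Prod>c\<in>orbit \<beta> ` (S - T). w c))"
      by (rule sum.reindex_bij_witness[where i = "\<lambda>(\<alpha>, \<beta>). \<alpha> \<circ> \<beta>"
            and j = "\<lambda>\<sigma>. (perm_restrict \<sigma> T, perm_restrict \<sigma> (S - T))"])
        (use split_off_orbit[OF S _ _ i] compose_full_cycle[OF S T] weight_split in auto)
    also have "\<dots> = real (card (full_cycles i T)) * w T * cycle_sum w (S - T)"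
      by (simp add: cycle_sum_def sum.cartesian_product[symmetric] sum_distrib_left[symmetric])
    finally show "(\<Sum>\<sigma> | \<sigma> \<in> {\<sigma>. \<sigma> permutes S} \<and> orbit \<sigma> i = T. \<Prod>c\<in>orbit \<sigma> ` S. w c) =
        real (card (full_cycles i T)) * w T * cycle_sum w (S - T)" .
  qed simp
  finally show ?thesis .
qed

lemma sum_fact_subsets:
  assumes "finite R"
  shows "(\<Sum>U\<in>Pow R. fact (card U) * fact (card R - card U) :: real) = fact (Suc (card R))"
proof -
  have "(\<Sum>U\<in>Pow R. fact (card U) * fact (card R - card U) :: real) =
      (\<Sum>u\<le>card R. \<Sum>U | U \<in> Pow R \<and> card U = u. fact (card U) * fact (card R - card U))"
    using assms by (intro sum.group[symmetric]) (auto intro: card_mono)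
  also have "\<dots> = (\<Sum>u\<le>card R. fact (card R))"
  proof (rule sum.cong)
    fix u assume u: "u \<in> {..card R}"
    have "(\<Sum>U | U \<in> Pow R \<and> card U = u. fact (card U) * fact (card R - card U) :: real) =
        real (card R choose u) * (fact u * fact (card R - u))"
      using n_subsets[OF assms, of u] by simp
    also have "\<dots> = fact (card R)"
      using u arg_cong[OF binomial_fact_lemma[of u "card R"], of real] by (simp add: mult_ac)
    finally show "(\<Sum>U | U \<in> Pow R \<and> card U = u. fact (card U) * fact (card R - card U) :: real) =
        fact (card R)" .
  qed simp
  finally show ?thesis by (simp add: algebra_simps)
qed

text \<open>With all weights \<open>1\<close>, splitting off the cycle of \<open>i\<close> expresses \<open>(card S)!\<close> through the numbers
  of full cycles on the subsets that contain \<open>i\<close>; by induction only the number for \<open>S\<close> itself is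
  unknown in this equation.\<close>

lemma card_full_cycles:
  assumes "finite S" "i \<in> S"
  shows "card (full_cycles i S) = fact (card S - 1)"
  using assms
proof (induction S rule: finite_psubset_induct)
  case (psubset S)
  define R where "R = S - {i}"
  have R: "finite R" "i \<notin> R" "S = insert i R" "card S = Suc (card R)"
    using psubset.hyps psubset.prems card.remove[of S i] by (auto simp: R_def)
  have fin: "finite T" if "T \<subseteq> S" for T
    using that psubset.hyps by (rule finite_subset)
  have one: "cycle_sum (\<lambda>_. 1) T = fact (card T)" if "T \<subseteq> S" for T
    using fin[OF that] by (simp add: cycle_sum_def card_permutations[OF refl])
  have "fact (Suc (card R)) = (\<Sum>T | T \<in> Pow S \<and> i \<in> T.
      real (card (full_cycles i T)) * fact (card S - card T))"
  proof -
    have "fact (card S) = (\<Sum>T | T \<in> Pow S \<and> i \<in> T.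
      real (card (full_cycles i T)) * 1 * cycle_sum (\<lambda>_. 1) (S - T))"
      using cycle_sum_split[OF psubset.hyps psubset.prems, of "\<lambda>_. 1"] one[of S] by simp
    also have "\<dots> = (\<Sum>T | T \<in> Pow S \<and> i \<in> T.
      real (card (full_cycles i T)) * fact (card S - card T))"
      using psubset.hyps by (intro sum.cong refl) (auto simp: one card_Diff_subset fin)
    finally show ?thesis using R by simp
  qed
  also have "\<dots> = (\<Sum>U\<in>Pow R. real (card (full_cycles i (insert i U))) * fact (card R - card U))"
  proof (rule sum.reindex_bij_witness[where i = "insert i" and j = "\<lambda>T. T - {i}"])
    fix T assume "T \<in> {T. T \<in> Pow S \<and> i \<in> T}"
    then have T: "T \<subseteq> S" "i \<in> T" "insert i (T - {i}) = T"
      by auto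
    then have "card S - card T = card R - card (T - {i})"
      using R(4) card.remove[of T i] fin by simp
    with T(3) show "real (card (full_cycles i (insert i (T - {i})))) * fact (card R - card (T - {i})) =
        real (card (full_cycles i T)) * fact (card S - card T)"
      by simp
  qed (use R in auto)
  also have "\<dots> = real (card (full_cycles i S)) +
      (\<Sum>U\<in>Pow R - {R}. real (card (full_cycles i (insert i U))) * fact (card R - card U))"
    using R by (subst sum.remove[of _ R]) auto
  also have "(\<Sum>U\<in>Pow R - {R}. real (card (full_cycles i (insert i U))) * fact (card R - card U)) =
      (\<Sum>U\<in>Pow R - {R}. fact (card U) * fact (card R - card U))"
  proof (rule sum.cong)
    fix U assume U: "U \<in> Pow R - {R}"
    then have "U \<subseteq> R" "insert i U \<subset> S" "i \<notin> U"
      using R by auto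
    then have "finite U"
      using R(1) by (blast intro: finite_subset)
    then show "real (card (full_cycles i (insert i U))) * fact (card R - card U) =
        fact (card U) * fact (card R - card U)"
      using psubset.IH[OF \<open>insert i U \<subset> S\<close>] \<open>i \<notin> U\<close> by simp
  qed simp
  also have "\<dots> = fact (Suc (card R)) - fact (card R)"
    using sum_fact_subsets[OF R(1)] R by (subst (asm) sum.remove[of _ R]) auto
  finally have "real (card (full_cycles i S)) = real (fact (card R))" by simp
  then show ?case
    using R by (simp only: of_nat_eq_iff) simp
qed

text \<open>The exponential formula. Splitting off the cycle of \<open>i\<close> and summing over \<open>i \<in> S\<close> counts each
  \<open>T\<close> with multiplicity \<open>card T\<close>, which is the equation \<open>euler g = euler l * g\<close>.\<close>

lemma coeff_set_exp_eq_cycle_sum: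
  assumes l: "\<And>T. T \<noteq> {} \<Longrightarrow> T \<subseteq> S \<Longrightarrow> coeff l T = fact (card T - 1) * w T"
    and S: "finite S"
  shows "coeff (set_exp l) S = cycle_sum w S"
  using S l
proof (induction S rule: finite_psubset_induct)
  case (psubset S)
  show ?case
  proof (cases "S = {}")
    case True
    then show ?thesis by (simp add: cycle_sum_def)
  next
    case False
    have "real (card S) * cycle_sum w S = (\<Sum>i\<in>S. cycle_sum w S)"
      by simp
    also have "\<dots> = (\<Sum>i\<in>S. \<Sum>T | T \<in> Pow S \<and> i \<in> T. coeff l T * coeff (set_exp l) (S - T))"
    proof (rule sum.cong)
      fix i assume i: "i \<in> S"
      show "cycle_sum w S = (\<Sum>T | T \<in> Pow S \<and> i \<in> T. coeff l T * coeff (set_exp l) (S - T))"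
        unfolding cycle_sum_split[OF psubset.hyps i]
      proof (rule sum.cong)
        fix T assume "T \<in> {T. T \<in> Pow S \<and> i \<in> T}"
        then have T: "T \<subseteq> S" "i \<in> T" "S - T \<subset> S" by auto
        then have "coeff (set_exp l) (S - T) = cycle_sum w (S - T)"
          by (intro psubset.IH psubset.prems) auto
        moreover have "coeff l T = real (card (full_cycles i T)) * w T"
          using T psubset by (subst card_full_cycles) (auto intro: finite_subset)
        ultimately show "real (card (full_cycles i T)) * w T * cycle_sum w (S - T) =
            coeff l T * coeff (set_exp l) (S - T)"
          by simp
      qed simp
    qed simp
    also have "\<dots> = (\<Sum>T\<in>Pow S. \<Sum>i | i \<in> S \<and> i \<in> T. coeff l T * coeff (set_exp l) (S - T))"
      using psubset.hyps by (intro sum.swap_restrict) auto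
    also have "\<dots> = (\<Sum>T\<in>Pow S. coeff (euler l) T * coeff (set_exp l) (S - T))"
    proof (rule sum.cong)
      fix T assume "T \<in> Pow S"
      then have "{i. i \<in> S \<and> i \<in> T} = T" by auto
      then show "(\<Sum>i | i \<in> S \<and> i \<in> T. coeff l T * coeff (set_exp l) (S - T)) =
          coeff (euler l) T * coeff (set_exp l) (S - T)"
        by simp
    qed simp
    also have "\<dots> = real (card S) * coeff (set_exp l) S"
      using coeff_euler[of "set_exp l" S] by (simp add: euler_set_exp coeff_mult del: coeff_euler)
    finally show ?thesis
      using False psubset.hyps by simp
  qed
qed

section \<open>Integrals of products of rectangles\<close>

lemma cube_integral_prod_rectangles:
  fixes r :: "nat \<Rightarrow> real ^ 'k"
  assumes c: "finite c" "c \<noteq> {}" and r: "\<And>i j. i \<in> c \<Longrightarrow> 0 \<le> r i $ j \<and> r i $ j \<le> 1"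
  shows "cube_integral (\<lambda>x. \<Prod>i\<in>c. indicator {x. \<forall>j. x $ j \<in> {0..r i $ j}} x) =
    (\<Prod>j\<in>UNIV. Min ((\<lambda>i. r i $ j) ` c))"
proof -
  define m :: "real ^ 'k" where "m = (\<chi> j. Min ((\<lambda>i. r i $ j) ` c))"
  have m: "0 \<le> m $ j" "m $ j \<le> 1" for j
  proof -
    have "Min ((\<lambda>i. r i $ j) ` c) \<in> (\<lambda>i. r i $ j) ` c"
      using c by (intro Min_in) auto
    then show "0 \<le> m $ j" "m $ j \<le> 1"
      using r by (auto simp: m_def)
  qed
  have "(\<Prod>i\<in>c. indicator {x. \<forall>j. x $ j \<in> {0..r i $ j}} x) = (indicator (cbox 0 m) x :: real)"
    for x :: "real ^ 'k"
  proof -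
    have "x \<in> cbox 0 m \<longleftrightarrow> (\<forall>i\<in>c. x \<in> {x. \<forall>j. x $ j \<in> {0..r i $ j}})"
      using c by (auto simp: mem_box_cart m_def)
    then show ?thesis
      using c by (auto simp: indicator_def)
  qed
  then have "cube_integral (\<lambda>x. \<Prod>i\<in>c. indicator {x. \<forall>j. x $ j \<in> {0..r i $ j}} x) =
      measure (lebesgue_on (cbox 0 1)) (cbox 0 m \<inter> cbox 0 1)"
    by (simp add: cube_integral_def)
  also have "cbox 0 m \<inter> cbox 0 1 = cbox 0 m"
    using m by (auto simp: mem_box_cart) (meson order_trans)
  also have "measure (lebesgue_on (cbox 0 1)) (cbox 0 m) = measure lebesgue (cbox 0 m)"
    using m by (intro measure_restrict_space) (auto simp: mem_box_cart, meson order_trans)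
  also have "\<dots> = (\<Prod>j\<in>UNIV. m $ j)"
  proof -
    have "0 \<in> cbox 0 m"
      using m by (simp add: mem_box_cart)
    then have "cbox 0 m \<noteq> {}"
      by blast
    then show ?thesis
      by (simp add: content_cbox_cart)
  qed
  finally show ?thesis
    by (simp add: m_def)
qed

theorem theorem3p5:
  fixes n :: nat and f :: "nat \<Rightarrow> real ^ 'k \<Rightarrow> real"
  assumes "n \<ge> 1"
    and "\<And>i. i \<in> {1..n} \<Longrightarrow> \<exists>R. k_rectangle R \<and> f i = indicator R"
  shows "E_n n f \<ge> 0"
proof -
  have "\<forall>i\<in>{1..n}. \<exists>r. (\<forall>j. 0 \<le> r $ j \<and> r $ j \<le> 1) \<and> f i = indicator {x. \<forall>j. x $ j \<in> {0..r $ j}}"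
    using assms(2) unfolding k_rectangle_def by blast
  then obtain r where rf: "\<forall>i\<in>{1..n}. (\<forall>j. 0 \<le> r i $ j \<and> r i $ j \<le> 1) \<and>
      f i = indicator {x. \<forall>j. x $ j \<in> {0..r i $ j}}"
    by (rule bchoice[THEN exE])
  then have r: "0 \<le> r i $ j \<and> r i $ j \<le> 1" if "i \<in> {1..n}" for i j
    using that by blast
  have f: "f i = indicator {x. \<forall>j. x $ j \<in> {0..r i $ j}}" if "i \<in> {1..n}" for i
    using rf that by blast
  \<comment> \<open>The sign in the weight of a cycle produces the factor \<open>(-1) ^ C\<close> for \<open>C\<close> cycles.\<close>
  define w where "w c = - cube_integral (\<lambda>x. \<Prod>i\<in>c. f i x)" for c
  define l where "l = set_series (\<lambda>T. fact (card T - 1) * w T)"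
  have "coeff l B = - fact (card B - 1) * (\<Prod>j\<in>UNIV. Min ((\<lambda>i. r i $ j) ` B))"
    if B: "B \<subseteq> {1..n}" "B \<noteq> {}" for B
  proof -
    have fin: "finite B"
      using B(1) by (rule finite_subset) simp
    have "(\<lambda>x. \<Prod>i\<in>B. f i x) = (\<lambda>x. \<Prod>i\<in>B. indicator {x. \<forall>j. x $ j \<in> {0..r i $ j}} x)"
      using B f by (intro ext prod.cong) auto
    moreover have "0 \<le> r i $ j \<and> r i $ j \<le> 1" if "i \<in> B" for i j
      using r that B by auto
    ultimately have "w B = - (\<Prod>j\<in>UNIV. Min ((\<lambda>i. r i $ j) ` B))"
      unfolding w_def using cube_integral_prod_rectangles[OF fin B(2), of r] by simp
    then show ?thesis
      using fin by (simp add: l_def coeff_set_series)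
  qed
  then have "coeff (set_exp l) {1..n} \<le> 0"
    using r assms(1) by (intro set_exp_prod_Min[of UNIV "{1..n}" "\<lambda>i j. r i $ j"]) auto
  moreover have "coeff (set_exp l) {1..n} = cycle_sum w {1..n}"
    by (rule coeff_set_exp_eq_cycle_sum) (auto simp: l_def coeff_set_series dest: finite_subset)
  moreover have "cycle_sum w {1..n} = - E_n n f"
    unfolding cycle_sum_def E_n_def sum_negf[symmetric]
  proof (rule sum.cong)
    fix \<sigma>
    have "0 < card (cycle_sets n \<sigma>)"
      using assms(1) by (auto simp: cycle_sets_def card_gt_0_iff)
    then obtain m where "card (cycle_sets n \<sigma>) = Suc m"
      using gr0_implies_Suc by blast
    then show "(\<Prod>c\<in>orbit \<sigma> ` {1..n}. w c) =
        - ((- 1) ^ (card (cycle_sets n \<sigma>) - 1) * E_perm n \<sigma> f)"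
      by (simp add: w_def E_perm_def cycle_sets_def prod_uminus)
  qed simp
  ultimately show ?thesis
    by simp
qed

end
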